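(* For every $l \geq 2$ and $t\geq 1$, $\mathit{fw}(\mathit{up}(l, t))=2t-1$.
   Context: A sequence $s$ contains a sequence $u$ if some subsequence of $s$ can be changed into $u$ by a one-to-one renaming of its letters. An $(r,s)$-formation is a concatenation of $s$ permutations of the same set of $r$ distinct letters. The formation width $\mathit{fw}(u)$ is the minimum $s$ such that there exists $r$ for which every $(r,s)$-formation contains $u$. $\mathit{up}(l,t)$ is the sequence $1\,2\ldots l$ repeated $t$ times (e.g. $\mathit{up}(3,3)=123123123$). *)

theory Defs
  imports Main "HOL-Library.Sublist" "HOL-Combinatorics.Multiset_Permutations"
begin

definition contains_seq :: "'a list \<Rightarrow> 'b list \<Rightarrow> bool" where
  "contains_seq s u \<longleftrightarrow> (\<exists>v f. subseq v s \<and> inj_on f (set v) \<and> map f v = u)"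

definition formation :: "nat \<Rightarrow> nat \<Rightarrow> 'a list \<Rightarrow> bool" where
  "formation r s xs \<longleftrightarrow>
     (\<exists>A ps. finite A \<and> card A = r \<and> length ps = s \<and>
        set ps \<subseteq> permutations_of_set A \<and> xs = concat ps)"

text \<open>
  The letters of the formations are natural numbers. Any infinite alphabet gives the same value,
  as containment is invariant under renaming letters.

  If no \<open>s\<close> had the required property, the value of \<open>LEAST\<close> would be unspecified, so an equation
  \<open>fw u = n\<close> can be proved only along with the existence of the minimum.
\<close>

definition fw :: "'b list \<Rightarrow> nat" where
  "fw u = (LEAST s. \<exists>r. \<forall>xs :: nat list. formation r s xs \<longrightarrow> contains_seq xs u)"

definition up :: "nat \<Rightarrow> nat \<Rightarrow> nat list" where
  "up l t = concat (replicate t [1..<Suc l])"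

end

theory Submission
  imports Defs
begin

text \<open>
  Upper bound: applying the Erdos-Szekeres theorem once per permutation yields \<open>l\<close> letters
  which, in a suitable order \<open>w\<close>, every one of the \<open>2 * t - 1\<close> permutations lists as \<open>w\<close> or as
  the reverse of \<open>w\<close>. One of the two orders occurs in at least \<open>t\<close> permutations.

  Lower bound: let the permutations be alternately increasing and decreasing. On two letters the
  formation reads \<open>xy yx xy yx \<dots>\<close>, so an alternation \<open>xyxy\<dots>\<close> in it exceeds the number of
  permutations by at most one in length, whereas \<open>up l t\<close> contains one of length \<open>2 * t\<close>.
\<close>

section \<open>Monotone subsequences common to several permutations\<close>

lemma subseq_distinct: "subseq xs ys \<Longrightarrow> distinct ys \<Longrightarrow> distinct xs"
  by (auto simp: subseq_conv_nths intro: distinct_nthsI)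

lemma subseq_set_subset: "subseq xs ys \<Longrightarrow> set xs \<subseteq> set ys"
  by (auto simp: subseq_conv_nths dest: in_set_nthsD)

lemma subseq_rev: "subseq xs ys \<Longrightarrow> subseq (rev xs) (rev ys)"
  by (induction rule: list_emb.induct) (auto intro: list_emb_append_mono)

text \<open>The first letter \<open>x\<close> of \<open>v\<close> splits \<open>p\<close>. Letters
  of \<open>v\<close> found before \<open>x\<close> in \<open>p\<close> allow \<open>x\<close> to be
  added to a reversed pattern; the others lie after \<open>x\<close> and allow it to be added to a
  pattern in the order of \<open>v\<close>. The recursion enters the larger class, about half of
  \<open>v\<close>, hence a bound by powers of 2, cruder than the classical quadratic one.\<close>

lemma erdos_szekeres_subseq:
  assumes "distinct v" "set v \<subseteq> set p" "2 ^ (a + b) \<le> length v"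
  shows "\<exists>w. subseq w v \<and>
    (length w = a \<and> subseq w p \<or> length w = b \<and> subseq (rev w) p)"
  using assms
proof (induction v arbitrary: a b p rule: length_induct)
  case (1 v)
  show ?case
  proof (cases "a = 0 \<or> b = 0")
    case True
    then show ?thesis by (intro exI[of _ "[]"]) auto
  next
    case False
    then obtain a' b' where ab: "a = Suc a'" "b = Suc b'"
      by (meson not0_implies_Suc)
    have "v \<noteq> []"
      using "1.prems"(3) by auto
    then obtain x v' where v: "v = x # v'"
      by (cases v) auto
    obtain p1 p2 where p: "p = p1 @ x # p2"
      using "1.prems"(2) v by (metis list.set_intros(1) split_list subsetD)
    define v1 where "v1 = filter (\<lambda>y. y \<in> set p1) v'"
    define v2 where "v2 = filter (\<lambda>y. y \<notin> set p1) v'"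
    have v1: "distinct v1" "set v1 \<subseteq> set p1" "length v1 < length v" "subseq v1 v'"
      using "1.prems"(1) by (auto simp: v1_def v less_Suc_eq_le)
    have v2: "distinct v2" "set v2 \<subseteq> set p2" "length v2 < length v" "subseq v2 v'"
      using "1.prems"(1,2) by (auto simp: v2_def v p less_Suc_eq_le)
    have "length v1 + length v2 = length v'"
      unfolding v1_def v2_def by (rule sum_length_filter_compl)
    \<comment> \<open>Both powers are half of \<open>2 ^ (a + b)\<close>. If both inequalities
      failed, \<open>v'\<close> would have at most \<open>2 ^ (a + b) - 2\<close> letters, one too
      few.\<close>
    then have "2 ^ (a + b') \<le> length v1 \<or> 2 ^ (a' + b) \<le> length v2"
      using "1.prems"(3) by (auto simp: ab v)
    then show ?thesis
    proof
      assume "2 ^ (a + b') \<le> length v1"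
      then obtain w where w: "subseq w v1"
        "length w = a \<and> subseq w p1 \<or> length w = b' \<and> subseq (rev w) p1"
        using "1.IH" v1 by blast
      have wv: "subseq w v'"
        using w(1) v1(4) by (rule subseq_order.trans)
      from w(2) show ?thesis
      proof
        assume "length w = a \<and> subseq w p1"
        then show ?thesis
          using wv by (intro exI[of _ w]) (auto simp: v p)
      next
        assume w': "length w = b' \<and> subseq (rev w) p1"
        \<comment> \<open>\<open>x\<close> precedes \<open>w\<close> in \<open>v\<close> but comes
          after \<open>p1\<close> in \<open>p\<close>, so it is the last letter of
          \<open>rev (x # w)\<close>.\<close>
        then have "subseq (rev w @ [x]) (p1 @ x # p2)"
          by (intro list_emb_append_mono) auto
        then show ?thesis
          using wv w' by (intro exI[of _ "x # w"]) (auto simp: v p ab)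
      qed
    next
      assume "2 ^ (a' + b) \<le> length v2"
      then obtain w where w: "subseq w v2"
        "length w = a' \<and> subseq w p2 \<or> length w = b \<and> subseq (rev w) p2"
        using "1.IH" v2 by blast
      have wv: "subseq w v'"
        using w(1) v2(4) by (rule subseq_order.trans)
      from w(2) show ?thesis
      proof
        assume "length w = a' \<and> subseq w p2"
        then show ?thesis
          using wv by (intro exI[of _ "x # w"]) (auto simp: v p ab)
      next
        assume "length w = b \<and> subseq (rev w) p2"
        then show ?thesis
          using wv by (intro exI[of _ w]) (auto simp: v p)
      qed
    qed
  qed
qed

text \<open>Being listed as \<open>w\<close> or as its reverse passes to subsequences of
  \<open>w\<close>, so the lists in \<open>ps\<close> can be treated one at a time. The bound
  \<open>r\<close> is uniform in \<open>v\<close> and \<open>ps\<close> because \<open>fw\<close>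
  fixes \<open>r\<close> before the formation is given.\<close>

lemma common_monotone_subseq:
  "\<exists>r. \<forall>v ps. distinct v \<and> r \<le> length v \<and> length ps = s \<and> (\<forall>p\<in>set ps. set v \<subseteq> set p) \<longrightarrow>
     (\<exists>w. subseq w v \<and> length w = n \<and> (\<forall>p\<in>set ps. subseq w p \<or> subseq (rev w) p))"
proof (induction s arbitrary: n)
  case 0
  show ?case
  proof (intro exI[of _ n] allI impI)
    fix v :: "'a list" and ps :: "'a list list"
    assume "distinct v \<and> n \<le> length v \<and> length ps = 0 \<and> (\<forall>p\<in>set ps. set v \<subseteq> set p)"
    then show "\<exists>w. subseq w v \<and> length w = n \<and> (\<forall>p\<in>set ps. subseq w p \<or> subseq (rev w) p)"
      by (intro exI[of _ "take n v"]) (auto intro: prefix_imp_subseq take_is_prefix)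
  qed
next
  case (Suc s)
  \<comment> \<open>\<open>2 ^ (n + n)\<close> letters are kept for the first \<open>s\<close>
    lists, so that Erdos-Szekeres with \<open>a = b = n\<close> leaves \<open>n\<close> of them for
    the remaining list.\<close>
  obtain r where r: "\<And>v ps. distinct v \<Longrightarrow> r \<le> length v \<Longrightarrow> length ps = s \<Longrightarrow>
      (\<And>p. p \<in> set ps \<Longrightarrow> set v \<subseteq> set p) \<Longrightarrow>
      \<exists>w::'a list. subseq w v \<and> length w = 2 ^ (n + n) \<and>
        (\<forall>p\<in>set ps. subseq w p \<or> subseq (rev w) p)"
    using Suc.IH[of "2 ^ (n + n)"] by blast
  show ?case
  proof (intro exI[of _ r] allI impI)
    fix v :: "'a list" and ps :: "'a list list"
    assume *: "distinct v \<and> r \<le> length v \<and> length ps = Suc s \<and> (\<forall>p\<in>set ps. set v \<subseteq> set p)"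
    then obtain p ps' where ps: "ps = p # ps'"
      by (cases ps) auto
    obtain u where u: "subseq u v" "length u = 2 ^ (n + n)"
      "\<forall>q\<in>set ps'. subseq u q \<or> subseq (rev u) q"
      using r[of v ps'] * by (auto simp: ps)
    have "distinct u"
      using u(1) * by (blast intro: subseq_distinct)
    moreover have "set u \<subseteq> set p"
      using u(1) * by (auto simp: ps dest: subseq_set_subset)
    ultimately obtain w where w: "subseq w u" "length w = n" "subseq w p \<or> subseq (rev w) p"
      using erdos_szekeres_subseq[of u p n n] u(2) by auto
    moreover have "subseq (rev w) (rev u)"
        using w(1) by (rule subseq_rev)
    ultimately show
      "\<exists>w. subseq w v \<and> length w = n \<and> (\<forall>p\<in>set ps. subseq w p \<or> subseq (rev w) p)"
      using u(1,3) unfolding ps by (intro exI[of _ w]) (auto intro: subseq_order.trans)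
  qed
qed

section \<open>Upper bound: copies of one pattern in a formation\<close>

text \<open>Greedy choice: each list that contains \<open>w\<close> supplies one copy until
  \<open>t\<close> are found, and the other lists are skipped.\<close>

lemma subseq_concat_replicate:
  assumes "t \<le> length (filter (subseq w) ps)"
  shows "subseq (concat (replicate t w)) (concat ps)"
  using assms
proof (induction ps arbitrary: t)
  case (Cons p ps)
  show ?case
  proof (cases "subseq w p \<and> t > 0")
    case True
    then obtain t' where "t = Suc t'"
      by (meson gr0_implies_Suc)
    then show ?thesis
      using Cons True by (auto intro: list_emb_append_mono)
  next
    case False
    then have "subseq (concat (replicate t w)) (concat ps)"
      using Cons by (cases "t = 0") auto
    then show ?thesis
      by (auto intro: subseq_drop_many)
  qed
qed simp

lemma contains_seq_up:
  assumes "distinct w" "length w = l" "subseq (concat (replicate t w)) xs"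
  shows "contains_seq xs (up l t)"
proof -
  \<comment> \<open>\<open>f\<close> sends the i-th letter of \<open>w\<close> to i. Elsewhere it is
    \<open>the None\<close>, which is harmless since only letters of \<open>w\<close> get
    renamed.\<close>
  define f where "f = the \<circ> map_of (zip w [1..<Suc l])"
  have "map f w = [1..<Suc l]"
    using assms(1,2) by (intro nth_equalityI) (auto simp: f_def map_of_zip_nth simp del: upt_Suc)
  moreover from this have "inj_on f (set w)"
    by (metis distinct_map distinct_upt)
  then have "inj_on f (set (concat (replicate t w)))"
    by (rule inj_on_subset) auto
  ultimately show ?thesis
    using assms(3) unfolding contains_seq_def up_def
    by (intro exI[of _ "concat (replicate t w)"] exI[of _ f]) (simp add: map_concat del: upt_Suc)
qed

lemma ex_formation_contains_up:
  assumes "t \<ge> 1"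
  shows "\<exists>r. \<forall>xs :: 'a list. formation r (2 * t - 1) xs \<longrightarrow> contains_seq xs (up l t)"
proof -
  obtain r where r: "\<forall>(v :: 'a list) ps.
      distinct v \<and> r \<le> length v \<and> length ps = 2 * t - 1 \<and> (\<forall>p\<in>set ps. set v \<subseteq> set p) \<longrightarrow>
      (\<exists>w. subseq w v \<and> length w = l \<and> (\<forall>p\<in>set ps. subseq w p \<or> subseq (rev w) p))"
    using common_monotone_subseq by (rule exE)
  have "contains_seq xs (up l t)" if "formation r (2 * t - 1) xs" for xs :: "'a list"
  proof -
    from that obtain A ps where A: "finite A" "card A = r" "length ps = 2 * t - 1"
      "set ps \<subseteq> permutations_of_set A" "xs = concat ps"
      unfolding formation_def by blast
    \<comment> \<open>An arbitrary listing of \<open>A\<close> serves as the reference order with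
      which every permutation is compared.\<close>
    obtain v where v: "set v = A" "distinct v"
      using A(1) finite_distinct_list by blast
    obtain w where w: "subseq w v" "length w = l"
      "\<And>p. p \<in> set ps \<Longrightarrow> subseq w p \<or> subseq (rev w) p"
    proof -
      have "r \<le> length v" "\<forall>p\<in>set ps. set v \<subseteq> set p"
        using A v distinct_card[OF v(2)] by (auto dest: permutations_of_setD(1))
      then show ?thesis
        using r A(3) v(2) that by blast
    qed
    have dist: "distinct w"
      using w(1) v(2) by (rule subseq_distinct)
    \<comment> \<open>Pigeonhole: a permutation without \<open>w\<close> contains
      \<open>rev w\<close>, so the two counts add up to at least \<open>2 * t - 1\<close> and cannot
      both be below \<open>t\<close>. The sum may be larger, as \<open>w\<close> and
      \<open>rev w\<close> coincide for \<open>l \<le> 1\<close>.\<close>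
    have "filter (\<lambda>p. \<not> subseq w p) ps = filter (\<lambda>p. \<not> subseq w p \<and> subseq (rev w) p) ps"
      using w(3) by (intro filter_cong) auto
    also have "length \<dots> \<le> length (filter (subseq (rev w)) ps)"
      by (induction ps) auto
    finally have "length ps \<le> length (filter (subseq w) ps) + length (filter (subseq (rev w)) ps)"
      using sum_length_filter_compl[of "subseq w" ps] by linarith
    then have "t \<le> length (filter (subseq w) ps) \<or> t \<le> length (filter (subseq (rev w)) ps)"
      using A(3) assms by linarith
    then show ?thesis
    proof
      assume "t \<le> length (filter (subseq w) ps)"
      from contains_seq_up[OF dist w(2) subseq_concat_replicate[OF this]] show ?thesis
        by (simp add: A(5))
    next
      assume "t \<le> length (filter (subseq (rev w)) ps)"
      from contains_seq_up[OF _ _ subseq_concat_replicate[OF this]] show ?thesis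
        using dist w(2) by (simp add: A(5))
    qed
  qed
  then show ?thesis
    by blast
qed

section \<open>Lower bound: alternations\<close>

text \<open>Serves on two levels: for the alternation of two letters, and for the blocks of a
  formation that alternates two permutations.\<close>

fun alternating :: "nat \<Rightarrow> 'a \<Rightarrow> 'a \<Rightarrow> 'a list" where
  "alternating 0 x y = []"
| "alternating (Suc n) x y = x # alternating n y x"

lemma length_alternating [simp]: "length (alternating n x y) = n"
  by (induction n x y rule: alternating.induct) auto

lemma set_alternating_subset: "set (alternating n x y) \<subseteq> {x, y}"
  by (induction n x y rule: alternating.induct) auto

lemma alternating_double: "alternating (2 * t) x y = concat (replicate t [x, y])"
  by (induction t) auto

text \<open>A block that lacks the next two letters in order can absorb only one letter.\<close>

lemma alternating_in_alternating_blocks: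
  assumes "\<not> subseq [x, y] p" "\<not> subseq [y, x] q"
    and "subseq (alternating n x y) (concat (alternating m p q))"
  shows "n \<le> m"
  using assms
proof (induction m arbitrary: n x y p q)
  case 0
  then show ?case by (cases n) auto
next
  case (Suc m)
  show ?case
  proof (cases n)
    case n: (Suc n')
    obtain us vs where uv: "alternating n x y = us @ vs" "subseq us p"
      "subseq vs (concat (alternating m q p))"
      using Suc.prems(3) by (auto simp: subseq_append_iff)
    \<comment> \<open>The first block absorbs at most \<open>x\<close>. Even if it absorbs nothing,
      \<open>x\<close> is dropped, so that letters and blocks swap together and the two hypotheses
      carry over.\<close>
    have "subseq (alternating n' y x) (concat (alternating m q p))"
    proof (cases us)
      case Nil
      then show ?thesis
        using uv n by (auto dest: subseq_Cons')
    next
      case (Cons z us')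
      have "us' = []"
      proof (rule ccontr)
        assume "us' \<noteq> []"
        then have "prefix [x, y] us"
          using uv(1) Cons n by (cases us'; cases n') auto
        then show False
          using uv(2) Suc.prems(1) by (blast intro: prefix_imp_subseq subseq_order.trans)
      qed
      then show ?thesis
        using uv n Cons by auto
    qed
    then have "n' \<le> m"
      using Suc by blast
    then show ?thesis
      using n by simp
  qed simp
qed

text \<open>Each round of \<open>up l t\<close> contains 1 2, and undoing the renaming turns these
  into two letters of \<open>xs\<close>.\<close>

lemma contains_seq_up_alternating:
  assumes "contains_seq xs (up l t)" "l \<ge> 2" "t \<ge> 1"
  shows "\<exists>x y. x \<noteq> y \<and> subseq (alternating (2 * t) x y) xs"
proof -
  obtain v f where v: "subseq v xs" "inj_on f (set v)" "map f v = up l t"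
    using assms(1) unfolding contains_seq_def by blast
  define g where "g = inv_into (set v) f"
  have "map g (up l t) = v"
    unfolding v(3)[symmetric] g_def using v(2) by (auto intro: map_idI)
  have l: "[1..<Suc l] = [1, 2] @ [3..<Suc l]"
    using assms(2) by (simp add: upt_conv_Cons numeral_eq_Suc del: upt_Suc)
  have "subseq [1, 2] [1..<Suc l]"
    unfolding l by (intro prefix_imp_subseq prefixI) (rule refl)
  then have "subseq (concat (replicate t [1, 2])) (up l t)"
    unfolding up_def by (intro subseq_concat_replicate) simp
  then have "subseq (map g (concat (replicate t [1, 2]))) v"
    using \<open>map g (up l t) = v\<close> subseq_map by metis
  then have "subseq (alternating (2 * t) (g 1) (g 2)) xs"
    using v(1) by (auto simp: map_concat alternating_double intro: subseq_order.trans)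
  \<comment> \<open>\<open>inv_into\<close> is a genuine inverse only on the image of
    \<open>f\<close>, so 1 and 2 must occur in \<open>up l t\<close>; this takes
    \<open>t \<ge> 1\<close> and \<open>l \<ge> 2\<close>.\<close>
  moreover have "g 1 \<noteq> g 2"
  proof -
    have "{1, 2} \<subseteq> set (up l t)"
      using assms(2,3) by (auto simp: up_def)
    then have "{1, 2} \<subseteq> f ` set v"
      by (metis v(3) set_map)
    then show ?thesis
      unfolding g_def by (metis f_inv_into_f insert_subset one_eq_numeral_iff semiring_norm(83))
  qed
  ultimately show ?thesis
    by blast
qed

text \<open>As \<open>r\<close> is arbitrary, enlarging the alphabet cannot rescue a smaller
  \<open>s\<close>.\<close>

lemma ex_formation_not_contains_up:
  assumes "l \<ge> 2" "s < 2 * t - 1"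
  shows "\<exists>xs :: nat list. formation r s xs \<and> \<not> contains_seq xs (up l t)"
proof -
  define I where "I = [0..<r]"
  define xs where "xs = concat (alternating s I (rev I))"
  have "formation r s xs"
    unfolding formation_def xs_def using set_alternating_subset[of s I "rev I"]
    by (intro exI[of _ "{0..<r}"] exI[of _ "alternating s I (rev I)"])
      (auto simp: I_def permutations_of_set_def)
  moreover have "\<not> contains_seq xs (up l t)"
  proof
    assume "contains_seq xs (up l t)"
    then obtain x y where xy: "x \<noteq> y" "subseq (alternating (2 * t) x y) xs"
      using contains_seq_up_alternating[of xs l t] assms by fastforce
    obtain n where n: "2 * t = Suc n"
      using assms(2) by (cases "2 * t") auto
    have less: "a < b" if "subseq [a, b] I" for a b
    proof -
      have "sorted [a, b]"
        using that unfolding I_def subseq_conv_nths by (metis sorted_nths sorted_upt)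
      moreover have "distinct [a, b]"
        using that unfolding I_def by (rule subseq_distinct) simp
      ultimately show ?thesis by auto
    qed
    have rev: "subseq [a, b] (rev I) \<longleftrightarrow> subseq [b, a] I" for a b
      using subseq_rev[of "[b, a]" I] subseq_rev[of "[a, b]" "rev I"] by auto
    show False
    proof (cases "x < y")
      case False
      \<comment> \<open>Here \<open>y < x\<close>: the increasing block lacks x y and the decreasing
        one lacks y x, so the bound on alternations applies directly.\<close>
      then have "2 * t \<le> s"
        using xy less rev unfolding xs_def by (intro alternating_in_alternating_blocks) auto
      then show False
        using assms(2) by simp
    next
      case True
      \<comment> \<open>The increasing first block may absorb both x and y. Dropping the leading
        \<open>x\<close> restores the hypotheses of the bound with the letters swapped; this lost
        letter is why the threshold is \<open>2 * t - 1\<close> and not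
        \<open>2 * t\<close>.\<close>
      have "subseq (alternating n y x) xs"
        using xy(2) n by (auto dest: subseq_Cons')
      then have "n \<le> s"
        using True less rev unfolding xs_def
        by (intro alternating_in_alternating_blocks) (auto dest: less)
      then show False
        using assms(2) n by simp
    qed
  qed
  ultimately show ?thesis
    by blast
qed

theorem theorem2p10:
  fixes l t :: nat
  assumes "l \<ge> 2" and "t \<ge> 1"
  shows "fw (up l t) = 2 * t - 1"
  unfolding fw_def
proof (rule Least_equality)
  show "\<exists>r. \<forall>xs :: nat list. formation r (2 * t - 1) xs \<longrightarrow> contains_seq xs (up l t)"
    using assms(2) by (rule ex_formation_contains_up)
next
  fix s
  assume "\<exists>r. \<forall>xs :: nat list. formation r s xs \<longrightarrow> contains_seq xs (up l t)"
  then show "2 * t - 1 \<le> s"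
    using ex_formation_not_contains_up[OF assms(1)] by (meson not_le)
qed

end
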